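(* Let $X=\{x_i\mid i\in I\}$ be a nonempty set indexed by a well-ordered set $I$, let $k$ be a field, and let $X^{**}$ be equipped with the deg-lex ordering $>$. Let $$S_0=\{([u][v])[w]-[u]([v][w])-([u][w])[v]+[u]([w][v])\ \mid\ [u],[v],[w]\in X^{**}\text{ are good words and }[v]>[w]\}.$$ Then $S_0$ is a Gröbner-Shirshov basis in the free non-associative algebra $M(X)$ over $k$.
   Context: Free non-associative algebra. $X^{**}$ is the set of all non-associative words (fully bracketed nonempty words) in $X$, i.e. the free magma on $X$; $|(u)|$ is the number of letters of $(u)$. $M(X)$ is the $k$-vector space with basis $X^{**}$ and multiplication extending $(u)(v)=((u)(v))$ bilinearly (the free non-associative, non-unital algebra on $X$). $X^*$ is the set of associative words in $X$, including the empty word. A subword of a non-associative word means a sub-bracketing: $(u)$ is a subword of itself, and the subwords of $(u_1)$ and of $(u_2)$ are subwords of $((u_1)(u_2))$. Deg-lex ordering on $X^{**}$: letters are ordered by $x_i>x_j$ iff $i>j$; otherwise $(u)>(v)$ iff either $|(u)|>|(v)|$, or $|(u)|=|(v)|$, $(u)=((u_1)(u_2))$, $(v)=((v_1)(v_2))$ and either $(u_1)>(v_1)$, or $(u_1)=(v_1)$ and $(u_2)>(v_2)$. This is a well ordering compatible with left and right multiplication. For nonzero $f\in M(X)$, $(\bar f)$ denotes its largest word occurring with nonzero coefficient (leading word); $f$ is monic if that coefficient is $1$. Good words in $X^{**}$, by induction on length: every letter $x_i\in X$ is a good word; a word $((v)(w))$ is a good word iff both $(v)$ and $(w)$ are good words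 and, if $(v)=((v_1)(v_2))$, then $(v_2)\le (w)$. One writes $[u]$ for $(u)$ when $(u)$ is a good word. $S$-words. Let $S\subset M(X)$ be a set of monic polynomials. $S$-words are defined inductively: each $s\in S$ is an $S$-word; if $p$ is an $S$-word and $(v)\in X^{**}$ then $p(v)$ and $(v)p$ are $S$-words. An $S$-word built from $s$ is written $(asb)$, where $a,b\in X^*$ are the letters to the left and right of $s$ (with the bracketing understood); $(a(\bar s)b)$ denotes the word obtained by replacing $s$ by $(\bar s)$ in it, and it is the leading word of $(asb)$. Compositions. For monic $f,g$ with $(\bar f)=(a(\bar g)b)$ for some $a,b\in X^*$ (i.e. $(\bar g)$ is a subword of $(\bar f)$ at a given position), the composition of inclusion is $(f,g)_{(\bar f)}=f-(agb)$. It is trivial modulo $(S,(\bar f))$ if it equals a finite sum $\sum_i\alpha_i(a_is_ib_i)$ with $\alpha_i\in k$, $s_i\in S$, $(a_is_ib_i)$ $S$-words and $(a_i(\bar s_i)b_i)<(\bar f)$ for all $i$. A nonempty set $S\subset M(X)$ of monic polynomials is a Gröbner-Shirshov basis in $M(X)$ if every composition $(f,g)_{(\bar f)}$ with $f,g\in S$ is trivial modulo $(S,(\bar f))$. *)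

theory Defs
  imports Complex_Main "HOL-Library.Poly_Mapping"
begin

text \<open>
  The letters \<open>x\<^sub>i\<close> are represented by their indices \<open>i\<close>, which range over a
  type of class \<^class>\<open>wellorder\<close>. Such a type is nonempty, as is \<open>X\<close>.
\<close>

datatype 'i word = Letter 'i | Node "'i word" "'i word" (infixl \<open>\<diamondop>\<close> 75)

primrec word_length :: "'i word \<Rightarrow> nat" where
  "word_length (Letter i) = 1"
| "word_length (v \<diamondop> w) = word_length v + word_length w"

text \<open>The two mixed cases are decided by length, since a letter is the shortest word.\<close>

fun deglex :: "'i::linorder word \<Rightarrow> 'i word \<Rightarrow> bool" where
  "deglex (Letter i) (Letter j) \<longleftrightarrow> i < j"
| "deglex (Letter i) (v1 \<diamondop> v2) \<longleftrightarrow> True"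
| "deglex (u1 \<diamondop> u2) (Letter j) \<longleftrightarrow> False"
| "deglex (u1 \<diamondop> u2) (v1 \<diamondop> v2) \<longleftrightarrow>
     word_length (u1 \<diamondop> u2) < word_length (v1 \<diamondop> v2) \<or>
     word_length (u1 \<diamondop> u2) = word_length (v1 \<diamondop> v2) \<and>
       (deglex u1 v1 \<or> u1 = v1 \<and> deglex u2 v2)"

lemma word_length_pos: "0 < word_length u"
  by (induction u) auto

lemma deglex_lengthI: "word_length u < word_length v \<Longrightarrow> deglex u v"
proof (cases "(u, v)" rule: deglex.cases)
  case (3 u1 u2 j)
  moreover assume "word_length u < word_length v"
  ultimately show ?thesis using word_length_pos[of u1] word_length_pos[of u2] by simp
qed auto

lemma deglex_irrefl: "\<not> deglex u u"
  by (induction u) auto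

lemma deglex_trans: "deglex u v \<Longrightarrow> deglex v w \<Longrightarrow> deglex u w"
proof (induction u arbitrary: v w)
  case (Letter i)
  then show ?case by (cases v; cases w) auto
next
  case (Node u1 u2)
  then show ?case by (cases v; cases w) auto
qed

lemma deglex_total: "deglex u v \<or> u = v \<or> deglex v u"
proof (induction u arbitrary: v)
  case (Letter i)
  then show ?case by (cases v) auto
next
  case (Node u1 u2)
  show ?case
  proof (cases v)
    case v: (Node v1 v2)
    show ?thesis using Node.IH(1)[of v1] Node.IH(2)[of v2] by (auto simp: v)
  qed simp
qed

instantiation word :: (linorder) linorder
begin

definition less_word :: "'a word \<Rightarrow> 'a word \<Rightarrow> bool" where
  "u < v \<longleftrightarrow> deglex u v"

definition less_eq_word :: "'a word \<Rightarrow> 'a word \<Rightarrow> bool" where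
  "u \<le> v \<longleftrightarrow> u = v \<or> deglex u v"

instance
  by standard
    (use deglex_irrefl deglex_trans deglex_total in
      \<open>unfold less_word_def less_eq_word_def, blast+\<close>)

end

fun good :: "'i::linorder word \<Rightarrow> bool" where
  "good (Letter i) \<longleftrightarrow> True"
| "good (Letter i \<diamondop> w) \<longleftrightarrow> good w"
| "good ((v1 \<diamondop> v2) \<diamondop> w) \<longleftrightarrow> good (v1 \<diamondop> v2) \<and> good w \<and> v2 \<le> w"

text \<open>
  The free non-associative algebra \<open>M(X)\<close> over \<open>'k\<close>: finitely supported functions from
  words to \<open>'k\<close>. The multiplication on \<^typ>\<open>'a \<Rightarrow>\<^sub>0 'b\<close> from the library presupposes a
  monoid of exponents, so the bilinear extension of \<open>\<diamondop>\<close> is defined separately.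
\<close>

type_synonym ('i, 'k) nalg = "'i word \<Rightarrow>\<^sub>0 'k"

abbreviation mono_word :: "'i word \<Rightarrow> ('i, 'k::field) nalg" (\<open>\<langle>_\<rangle>\<close>) where
  "\<langle>u\<rangle> \<equiv> Poly_Mapping.single u 1"

definition nmult :: "('i, 'k::field) nalg \<Rightarrow> ('i, 'k) nalg \<Rightarrow> ('i, 'k) nalg"
    (infixl \<open>\<odot>\<close> 70) where
  "f \<odot> g = (\<Sum>u\<in>Poly_Mapping.keys f. \<Sum>v\<in>Poly_Mapping.keys g.
      Poly_Mapping.single (u \<diamondop> v) (Poly_Mapping.lookup f u * Poly_Mapping.lookup g v))"

lemma nmult_words: "\<langle>u\<rangle> \<odot> \<langle>v\<rangle> = (\<langle>u \<diamondop> v\<rangle> :: ('i, 'k::field) nalg)"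
  by (simp add: nmult_def)

definition scale :: "'k::field \<Rightarrow> ('i, 'k) nalg \<Rightarrow> ('i, 'k) nalg" where
  "scale \<alpha> f = Poly_Mapping.map (\<lambda>c. \<alpha> * c) f"

text \<open>Meaningful only for nonzero \<open>f\<close>.\<close>

definition lead_word :: "('i::linorder, 'k::field) nalg \<Rightarrow> 'i word" where
  "lead_word f = Max (Poly_Mapping.keys f)"

definition monic :: "('i::linorder, 'k::field) nalg \<Rightarrow> bool" where
  "monic f \<longleftrightarrow> f \<noteq> 0 \<and> Poly_Mapping.lookup f (lead_word f) = 1"

inductive S_word :: "('i, 'k::field) nalg set \<Rightarrow> ('i, 'k) nalg \<Rightarrow> bool" for S where
  base: "s \<in> S \<Longrightarrow> S_word S s"
| right: "S_word S p \<Longrightarrow> S_word S (p \<odot> \<langle>v\<rangle>)"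
| left: "S_word S p \<Longrightarrow> S_word S (\<langle>v\<rangle> \<odot> p)"

text \<open>
  A bracketed word with exactly one hole. It records the data \<open>a\<close>, \<open>b\<close> and the bracketing in the
  notation \<open>(asb)\<close>: the S-word \<open>(asb)\<close> is \<open>fill_poly C s\<close>, and the word \<open>(a(u)b)\<close> is
  \<open>fill_word C u\<close>. Different holes distinguish different occurrences of the same subword.
\<close>

datatype 'i ctxt = Hole | CtxtL "'i ctxt" "'i word" | CtxtR "'i word" "'i ctxt"

primrec fill_word :: "'i ctxt \<Rightarrow> 'i word \<Rightarrow> 'i word" where
  "fill_word Hole u = u"
| "fill_word (CtxtL C v) u = fill_word C u \<diamondop> v"
| "fill_word (CtxtR v C) u = v \<diamondop> fill_word C u"

primrec fill_poly :: "'i ctxt \<Rightarrow> ('i, 'k::field) nalg \<Rightarrow> ('i, 'k) nalg" where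
  "fill_poly Hole s = s"
| "fill_poly (CtxtL C v) s = fill_poly C s \<odot> \<langle>v\<rangle>"
| "fill_poly (CtxtR v C) s = \<langle>v\<rangle> \<odot> fill_poly C s"

lemma S_word_iff: "S_word S p \<longleftrightarrow> (\<exists>s\<in>S. \<exists>C. p = fill_poly C s)"
proof
  assume "S_word S p"
  then show "\<exists>s\<in>S. \<exists>C. p = fill_poly C s"
    by induction (metis fill_poly.simps)+
next
  have "S_word S (fill_poly C s)" if "s \<in> S" for C s
    using that by (induction C) (auto intro: S_word.intros)
  then show "\<exists>s\<in>S. \<exists>C. p = fill_poly C s \<Longrightarrow> S_word S p" by blast
qed

lemma fill_poly_word: "fill_poly C \<langle>u\<rangle> = (\<langle>fill_word C u\<rangle> :: ('i, 'k::field) nalg)"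
  by (induction C) (simp_all add: nmult_words)

text \<open>A finite sum is given by a list of its summands; repetitions and the empty sum are allowed.\<close>

definition trivial_mod ::
    "('i::linorder, 'k::field) nalg set \<Rightarrow> 'i word \<Rightarrow> ('i, 'k) nalg \<Rightarrow> bool" where
  "trivial_mod S w h \<longleftrightarrow>
    (\<exists>ts :: ('k \<times> 'i ctxt \<times> ('i, 'k) nalg) list.
       (\<forall>(\<alpha>, C, s) \<in> set ts. s \<in> S \<and> fill_word C (lead_word s) < w) \<and>
       h = (\<Sum>(\<alpha>, C, s) \<leftarrow> ts. scale \<alpha> (fill_poly C s)))"

text \<open>
  \<open>composition C f g h\<close>: \<open>h\<close> is the composition of inclusion of \<open>f\<close> and \<open>g\<close> for the occurrence of
  the leading word of \<open>g\<close> in that of \<open>f\<close> given by \<open>C\<close>.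
\<close>

definition composition ::
    "'i::linorder ctxt \<Rightarrow> ('i, 'k::field) nalg \<Rightarrow> ('i, 'k) nalg \<Rightarrow> ('i, 'k) nalg \<Rightarrow> bool" where
  "composition C f g h \<longleftrightarrow> lead_word f = fill_word C (lead_word g) \<and> h = f - fill_poly C g"

definition groebner_shirshov_basis :: "('i::linorder, 'k::field) nalg set \<Rightarrow> bool" where
  "groebner_shirshov_basis S \<longleftrightarrow>
    S \<noteq> {} \<and> (\<forall>f\<in>S. monic f) \<and>
    (\<forall>f\<in>S. \<forall>g\<in>S. \<forall>C h. composition C f g h \<longrightarrow> trivial_mod S (lead_word f) h)"

definition S\<^sub>0 :: "('i::linorder, 'k::field) nalg set" where
  "S\<^sub>0 = {(\<langle>u\<rangle> \<odot> \<langle>v\<rangle>) \<odot> \<langle>w\<rangle> - \<langle>u\<rangle> \<odot> (\<langle>v\<rangle> \<odot> \<langle>w\<rangle>) - (\<langle>u\<rangle> \<odot> \<langle>w\<rangle>) \<odot> \<langle>v\<rangle> + \<langle>u\<rangle> \<odot> (\<langle>w\<rangle> \<odot> \<langle>v\<rangle>)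
         | u v w. good u \<and> good v \<and> good w \<and> v > w}"

end

theory Submission
  imports Defs
begin

text \<open>
  Write \<open>F(u,v,w) = (u,v,w) - (u,w,v)\<close>, where \<open>(u,v,w)\<close> is the associator, so that \<open>S\<^sub>0\<close> consists of
  the \<open>F(u,v,w)\<close> with \<open>u\<close>, \<open>v\<close>, \<open>w\<close> good and \<open>v > w\<close>; the leading word is \<open>(uv)w\<close>. Every word is,
  modulo S-words that do not exceed it, a combination of good words that do not exceed it. Hence
  \<open>F(u,v,w)\<close>, for arbitrary words, is a combination of S-words bounded by the larger of \<open>(uv)w\<close> and
  \<open>(uw)v\<close>. As a good word contains no leading word of an element of \<open>S\<^sub>0\<close>, the only nonzero
  compositions are \<open>F(ab,c,d) - F(a,b,c)d\<close> with \<open>b > c > d\<close>. Going around the hexagon of the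
  permutations of \<open>b,c,d\<close>, this equals
  \[ F(ac,b,d) - F(ad,b,c) + F(a,c,d)b - F(a,b,d)c - F(a,b,[c,d]) + F(a,c,[b,d]) - F(a,d,[b,c])
     + a(F(b,c,d) + F(c,d,b) + F(d,b,c)), \]
  and all bounds are smaller than \<open>((ab)c)d\<close>.
\<close>

section \<open>The deg-lex ordering\<close>

lemma word_less_simps [simp]:
  "Letter i < Letter j \<longleftrightarrow> i < j"
  "Letter i < v \<diamondop> w"
  "\<not> v \<diamondop> w < Letter i"
  by (simp_all add: less_word_def)

lemma word_less_Node:
  "u1 \<diamondop> u2 < v1 \<diamondop> v2 \<longleftrightarrow>
     word_length u1 + word_length u2 < word_length v1 + word_length v2 \<or>
     word_length u1 + word_length u2 = word_length v1 + word_length v2 \<and>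
       (u1 < v1 \<or> u1 = v1 \<and> u2 < v2)"
  by (simp add: less_word_def)

lemma word_less_lengthI: "word_length u < word_length v \<Longrightarrow> u < v"
  by (simp add: less_word_def deglex_lengthI)

lemma word_less_lengthD: "u < v \<Longrightarrow> word_length u \<le> word_length v"
  using word_less_lengthI[of v u] by (meson leI less_asym)

lemma Node_le_mono: "u \<le> u' \<Longrightarrow> v \<le> v' \<Longrightarrow> u \<diamondop> v \<le> u' \<diamondop> v'"
  using word_less_lengthD[of u u'] word_less_lengthD[of v v']
  by (auto simp: le_less word_less_Node)

text \<open>Within one length, products are compared lexicographically by their factors, which are
  shorter and so accessible by induction on the length. Letters inherit well-foundedness from the
  index type.\<close>

lemma wfp_word_less: "wfp ((<) :: 'i::wellorder word \<Rightarrow> _)"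
proof -
  have "Wellfounded.accp (<) u" for u :: "'i word"
  proof (induction "word_length u" arbitrary: u rule: less_induct)
    case less
    show ?case
    proof (cases u)
      case (Letter i)
      have "Wellfounded.accp (<) (Letter i)"
      proof (induction i rule: less_induct)
        case (less i)
        have "Wellfounded.accp (<) y" if "y < Letter i" for y
          using that less by (cases y) auto
        then show ?case by (rule accpI)
      qed
      then show ?thesis using Letter by simp
    next
      case (Node v w)
      \<comment> \<open>All products of the length of \<open>u\<close> are treated at once, since a
        descent may change the lengths of both factors.\<close>
      have "Wellfounded.accp (<) (v' \<diamondop> w')"
        if "word_length v' + word_length w' = word_length u" for v' w' :: "'i word"
      proof -
        have "Wellfounded.accp (<) v'"
          using that word_length_pos[of w'] by (intro less) auto
        then show ?thesis using that
        proof (induction v' arbitrary: w' rule: accp_induct_rule)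
          case (1 v')
          have "Wellfounded.accp (<) w'"
            using 1(3) word_length_pos[of v'] by (intro less) auto
          then show ?case using 1(3)
          proof (induction w' rule: accp_induct_rule)
            case (1 w')
            have "Wellfounded.accp (<) y" if "y < v' \<diamondop> w'" for y
            proof (cases "word_length y < word_length u")
              case True
              then show ?thesis by (rule less)
            next
              case False
              then obtain y1 y2 where y: "y = y1 \<diamondop> y2"
                using Node word_length_pos[of v] word_length_pos[of w] by (cases y) auto
              show ?thesis
                using that False \<open>word_length v' + word_length w' = word_length u\<close> "1.IH"
                  \<open>\<And>y w'. y < v' \<Longrightarrow> word_length y + word_length w' = word_length u \<Longrightarrow>
                     Wellfounded.accp (<) (y \<diamondop> w')\<close>
                unfolding y word_less_Node by auto
            qed
            then show ?case by (rule accpI)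
          qed
        qed
      qed
      then show ?thesis using Node by simp
    qed
  qed
  then show ?thesis by (simp add: wfp_iff_accp)
qed

lemma good_NodeD: "good (v \<diamondop> w) \<Longrightarrow> good v \<and> good w"
  by (cases v) auto

lemma good_fill_wordD: "good (fill_word C u) \<Longrightarrow> good u"
  by (induction C) (auto dest: good_NodeD)

lemma bad_NodeE:
  assumes "good v" "good w" "\<not> good (v \<diamondop> w)"
  obtains v1 v2 where "v = v1 \<diamondop> v2" "w < v2"
  using assms by (cases v) auto

section \<open>Bilinearity\<close>

lemma lookup_scale [simp]: "Poly_Mapping.lookup (scale \<alpha> f) u = \<alpha> * Poly_Mapping.lookup f u"
  by (simp add: scale_def Poly_Mapping.map.rep_eq when_def)

lemma lookup_nmult_Letter [simp]: "Poly_Mapping.lookup (f \<odot> g) (Letter i) = 0"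
  by (simp add: nmult_def Poly_Mapping.lookup_sum Poly_Mapping.lookup_single when_def)

text \<open>A word that is not a letter factors in exactly one way, so the double sum collapses to
  one term.\<close>

lemma lookup_nmult_Node [simp]:
  "Poly_Mapping.lookup (f \<odot> g) (u \<diamondop> v) = Poly_Mapping.lookup f u * Poly_Mapping.lookup g v"
proof -
  have "Poly_Mapping.lookup (f \<odot> g) (u \<diamondop> v) =
      (\<Sum>u'\<in>Poly_Mapping.keys f. \<Sum>v'\<in>Poly_Mapping.keys g.
        if v' = v then if u' = u then Poly_Mapping.lookup f u' * Poly_Mapping.lookup g v' else 0 else 0)"
    unfolding nmult_def Poly_Mapping.lookup_sum Poly_Mapping.lookup_single when_def
    by (intro sum.cong) auto
  also have "\<dots> = (\<Sum>u'\<in>Poly_Mapping.keys f. if u' = u then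
      (if v \<in> Poly_Mapping.keys g then Poly_Mapping.lookup f u' * Poly_Mapping.lookup g v else 0) else 0)"
    by (intro sum.cong) (auto simp: sum.delta)
  also have "\<dots> = Poly_Mapping.lookup f u * Poly_Mapping.lookup g v"
    by (simp add: sum.delta Poly_Mapping.in_keys_iff)
  finally show ?thesis .
qed

lemma nalg_eqI:
  assumes "\<And>i. Poly_Mapping.lookup f (Letter i) = Poly_Mapping.lookup g (Letter i)"
    and "\<And>u v. Poly_Mapping.lookup f (u \<diamondop> v) = Poly_Mapping.lookup g (u \<diamondop> v)"
  shows "f = g"
  by (rule poly_mapping_eqI) (metis assms word.exhaust)

lemmas lookup_simps = Poly_Mapping.lookup_add Poly_Mapping.lookup_minus

interpretation nalg: vector_space "scale :: 'k::field \<Rightarrow> ('i, 'k) nalg \<Rightarrow> ('i, 'k) nalg"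
  by standard (auto intro!: poly_mapping_eqI simp: lookup_simps algebra_simps)

lemma nmult_linear:
  "(f + g) \<odot> h = f \<odot> h + g \<odot> h" "h \<odot> (f + g) = h \<odot> f + h \<odot> g"
  "(f - g) \<odot> h = f \<odot> h - g \<odot> h" "h \<odot> (f - g) = h \<odot> f - h \<odot> g"
  "scale \<alpha> f \<odot> h = scale \<alpha> (f \<odot> h)" "h \<odot> scale \<alpha> f = scale \<alpha> (h \<odot> f)"
  "0 \<odot> h = 0" "h \<odot> 0 = 0"
  by (auto intro!: nalg_eqI simp: lookup_simps algebra_simps)

text \<open>The F of the overview, whose vanishing is right symmetry. Its arguments are algebra
  elements, so that by trilinearity each can be replaced by a combination of words.\<close>

definition rs :: "('i, 'k::field) nalg \<Rightarrow> ('i, 'k) nalg \<Rightarrow> ('i, 'k) nalg \<Rightarrow> ('i, 'k) nalg" where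
  "rs f g h = (f \<odot> g) \<odot> h - f \<odot> (g \<odot> h) - (f \<odot> h) \<odot> g + f \<odot> (h \<odot> g)"

lemma rs_linear:
  "rs (f + f') g h = rs f g h + rs f' g h" "rs f (g + g') h = rs f g h + rs f g' h"
  "rs f g (h + h') = rs f g h + rs f g h'"
  "rs (scale \<alpha> f) g h = scale \<alpha> (rs f g h)" "rs f (scale \<alpha> g) h = scale \<alpha> (rs f g h)"
  "rs f g (scale \<alpha> h) = scale \<alpha> (rs f g h)"
  "rs 0 g h = 0" "rs f 0 h = 0" "rs f g 0 = 0"
  by (simp_all add: rs_def nmult_linear nalg.scale_right_distrib nalg.scale_right_diff_distrib)

lemma rs_swap: "rs f h g = - rs f g h"
  by (simp add: rs_def)

lemma rs_words:
  "rs \<langle>u\<rangle> \<langle>v\<rangle> \<langle>w\<rangle> = \<langle>u \<diamondop> v \<diamondop> w\<rangle> - \<langle>u \<diamondop> (v \<diamondop> w)\<rangle> - \<langle>u \<diamondop> w \<diamondop> v\<rangle> + \<langle>u \<diamondop> (w \<diamondop> v)\<rangle>"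
  by (simp add: rs_def nmult_words)

lemma S\<^sub>0_eq: "S\<^sub>0 = {rs \<langle>u\<rangle> \<langle>v\<rangle> \<langle>w\<rangle> | u v w. good u \<and> good v \<and> good w \<and> w < v}"
  by (simp add: S\<^sub>0_def rs_def)

section \<open>Spans of S-words with prescribed leading words\<close>

text \<open>A set of admissible leading words covers weak bounds \<open>{..t}\<close> and strict
  bounds \<open>{..<t}\<close> alike, and can be moved along multiplication by a word.\<close>

definition S_words_in :: "'i::linorder word set \<Rightarrow> ('i, 'k::field) nalg set" where
  "S_words_in A = {fill_poly C s | C s. s \<in> S\<^sub>0 \<and> fill_word C (lead_word s) \<in> A}"

abbreviation S_span :: "'i::linorder word set \<Rightarrow> ('i, 'k::field) nalg set" where
  "S_span A \<equiv> nalg.span (S_words_in A)"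

lemma S_words_in_mono: "A \<subseteq> B \<Longrightarrow> S_words_in A \<subseteq> S_words_in B"
  by (auto simp: S_words_in_def)

lemma S_span_mono: "h \<in> S_span A \<Longrightarrow> A \<subseteq> B \<Longrightarrow> h \<in> S_span B"
  using nalg.span_mono[OF S_words_in_mono] by blast

lemma span_linear_image:
  assumes "f \<in> nalg.span A"
    and "\<And>f g. \<phi> (f + g) = \<phi> f + \<phi> g" "\<And>\<alpha> f. \<phi> (scale \<alpha> f) = scale \<alpha> (\<phi> f)" "\<phi> 0 = 0"
    and "\<And>f. f \<in> A \<Longrightarrow> \<phi> f \<in> nalg.span B"
  shows "\<phi> f \<in> nalg.span B"
  using assms(1)
  by (induction rule: nalg.span_induct_alt)
    (auto simp: assms intro!: nalg.span_add nalg.span_scale nalg.span_zero)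

lemma S_words_in_right: "f \<in> S_words_in A \<Longrightarrow> f \<odot> \<langle>v\<rangle> \<in> S_words_in ((\<lambda>u. u \<diamondop> v) ` A)"
  by (force simp: S_words_in_def intro: exI[of _ "CtxtL _ v"])

lemma S_words_in_left: "f \<in> S_words_in A \<Longrightarrow> \<langle>v\<rangle> \<odot> f \<in> S_words_in ((\<lambda>u. v \<diamondop> u) ` A)"
  by (force simp: S_words_in_def intro: exI[of _ "CtxtR v _"])

lemma S_span_right: "f \<in> S_span A \<Longrightarrow> f \<odot> \<langle>v\<rangle> \<in> S_span ((\<lambda>u. u \<diamondop> v) ` A)"
  by (erule span_linear_image[of _ _ "\<lambda>f. f \<odot> \<langle>v\<rangle>"])
    (auto simp: nmult_linear intro: nalg.span_base S_words_in_right)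

lemma S_span_left: "f \<in> S_span A \<Longrightarrow> \<langle>v\<rangle> \<odot> f \<in> S_span ((\<lambda>u. v \<diamondop> u) ` A)"
  by (erule span_linear_image[of _ _ "\<lambda>f. \<langle>v\<rangle> \<odot> f"])
    (auto simp: nmult_linear intro: nalg.span_base S_words_in_left)

lemma S_span_right_le: "f \<in> S_span {..u} \<Longrightarrow> u \<diamondop> v \<le> t \<Longrightarrow> f \<odot> \<langle>v\<rangle> \<in> S_span {..t}"
  by (erule S_span_right[THEN S_span_mono]) (auto intro: order_trans[OF Node_le_mono])

lemma S_span_left_le: "f \<in> S_span {..u} \<Longrightarrow> v \<diamondop> u \<le> t \<Longrightarrow> \<langle>v\<rangle> \<odot> f \<in> S_span {..t}"
  by (erule S_span_left[THEN S_span_mono]) (auto intro: order_trans[OF Node_le_mono])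

text \<open>Span induction adds one scaled S-word at a time, which becomes the new head of the list
  of summands.\<close>

lemma trivial_mod_S_span:
  assumes "h \<in> S_span {..<w}"
  shows "trivial_mod S\<^sub>0 w h"
  using assms
proof (induction rule: nalg.span_induct_alt)
  case base
  show ?case unfolding trivial_mod_def by (rule exI[of _ "[]"]) simp
next
  case (step \<alpha> f g)
  then obtain C s where f: "f = fill_poly C s" "s \<in> S\<^sub>0" "fill_word C (lead_word s) < w"
    by (auto simp: S_words_in_def)
  from step obtain ts where "\<forall>(\<alpha>, C, s) \<in> set ts. s \<in> S\<^sub>0 \<and> fill_word C (lead_word s) < w"
      "g = (\<Sum>(\<alpha>, C, s) \<leftarrow> ts. scale \<alpha> (fill_poly C s))"
    by (auto simp: trivial_mod_def)
  with f show ?case unfolding trivial_mod_def by (intro exI[of _ "(\<alpha>, C, s) # ts"]) auto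
qed

section \<open>Leading words\<close>

lemma assoc_less: "u \<diamondop> (v \<diamondop> w) < u \<diamondop> v \<diamondop> w"
  using word_length_pos[of v] word_less_lengthI[of u "u \<diamondop> v"] by (simp add: word_less_Node)

lemma swap_less: "w < v \<Longrightarrow> u \<diamondop> w \<diamondop> v < u \<diamondop> v \<diamondop> w"
  using word_less_lengthD[of w v] by (auto simp: word_less_Node)

lemma swap_assoc_less: "w < v \<Longrightarrow> u \<diamondop> (w \<diamondop> v) < u \<diamondop> v \<diamondop> w"
  using assoc_less swap_less less_trans by blast

lemma lead_word_rs:
  assumes "w < v"
  shows "lead_word (rs \<langle>u\<rangle> \<langle>v\<rangle> \<langle>w\<rangle> :: ('i::linorder, 'k::field) nalg) = u \<diamondop> v \<diamondop> w"
    and "monic (rs \<langle>u\<rangle> \<langle>v\<rangle> \<langle>w\<rangle> :: ('i, 'k) nalg)"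
proof -
  let ?f = "rs \<langle>u\<rangle> \<langle>v\<rangle> \<langle>w\<rangle> :: ('i, 'k) nalg" and ?t = "u \<diamondop> v \<diamondop> w"
  \<comment> \<open>The other three words are strictly below (uv)w, so nothing cancels its
    coefficient 1.\<close>
  note less = assoc_less[of u v w] swap_less[OF assms, of u] swap_assoc_less[OF assms, of u]
  have 1: "Poly_Mapping.lookup ?f ?t = 1"
    using less unfolding rs_words
    by (auto simp: lookup_simps Poly_Mapping.lookup_single when_def)
  have le: "x \<le> ?t" if "x \<in> Poly_Mapping.keys ?f" for x
    using that less unfolding Poly_Mapping.in_keys_iff rs_words
    by (auto simp: lookup_simps Poly_Mapping.lookup_single when_def split: if_splits)
  show lead: "lead_word ?f = ?t"
    unfolding lead_word_def using 1 le
    by (intro Max_eqI) (auto simp: Poly_Mapping.in_keys_iff)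
  show "monic ?f"
    using 1 unfolding monic_def lead by auto
qed

section \<open>Reduction to good words\<close>

text \<open>\<open>rs\<close> changes sign when its last two arguments are swapped and vanishes when
  they agree. Up to sign it is thus zero or in \<open>S\<^sub>0\<close>, and either of the two
  bounded words can be the leading one.\<close>

lemma rs_good:
  assumes "good u" "good v" "good w" "u \<diamondop> v \<diamondop> w \<le> t" "u \<diamondop> w \<diamondop> v \<le> t"
  shows "rs \<langle>u\<rangle> \<langle>v\<rangle> \<langle>w\<rangle> \<in> S_span {..t}"
proof -
  have *: "rs \<langle>u\<rangle> \<langle>x\<rangle> \<langle>y\<rangle> \<in> S_span {..t}"
    if "good x" "good y" "y < x" "u \<diamondop> x \<diamondop> y \<le> t" for x y
  proof -
    have "rs \<langle>u\<rangle> \<langle>x\<rangle> \<langle>y\<rangle> \<in> S\<^sub>0" using that assms(1) unfolding S\<^sub>0_eq by blast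
    then have "rs \<langle>u\<rangle> \<langle>x\<rangle> \<langle>y\<rangle> \<in> S_words_in {..t}"
      using that unfolding S_words_in_def by (intro CollectI exI[of _ Hole] exI) (auto simp: lead_word_rs)
    then show ?thesis by (rule nalg.span_base)
  qed
  consider "w < v" | "v = w" | "v < w" by fastforce
  then show ?thesis
  proof cases
    case 2
    then show ?thesis by (simp add: rs_def nalg.span_zero)
  next
    case 3
    then show ?thesis using * assms nalg.span_neg by (subst rs_swap) blast
  qed (use * assms in auto)
qed

abbreviation normal_span :: "'i::linorder word \<Rightarrow> ('i, 'k::field) nalg set" where
  "normal_span t \<equiv> nalg.span (mono_word ` {u. good u \<and> u \<le> t} \<union> S_words_in {..t})"

lemma normal_span_mono: "f \<in> normal_span u \<Longrightarrow> u \<le> t \<Longrightarrow> f \<in> normal_span t"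
  by (rule subsetD[OF nalg.span_mono[OF Un_mono[OF _ S_words_in_mono]]]) auto

lemma S_span_normal_span: "f \<in> S_span {..t} \<Longrightarrow> f \<in> normal_span t"
  by (rule subsetD[OF nalg.span_mono]) auto

text \<open>A bad factor is rewritten by the induction hypothesis. If both factors are good and
  \<open>t\<close> is not, then \<open>t\<close> is the leading word of an element of
  \<open>S\<^sub>0\<close>.\<close>

lemma word_in_normal_span: "(\<langle>t\<rangle> :: ('i::wellorder, 'k::field) nalg) \<in> normal_span t"
proof (induction t rule: wfp_induct_rule[OF wfp_word_less])
  case (1 t)
  have IH: "(\<langle>y\<rangle> :: ('i, 'k) nalg) \<in> normal_span t" if "y < t" for y
    using 1[OF that] that by (auto intro: normal_span_mono)
  show ?case
  proof (cases "good t")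
    case True
    then show ?thesis by (intro nalg.span_base) auto
  next
    case False
    then obtain v w where t: "t = v \<diamondop> w" by (cases t) auto
    have vt: "v < t" and wt: "w < t"
      using word_length_pos[of v] word_length_pos[of w] by (auto simp: t intro!: word_less_lengthI)
    consider "\<not> good v" | "\<not> good w" | "good v" "good w" by blast
    then show ?thesis
    proof cases
      assume v: "\<not> good v"
      have "\<langle>v\<rangle> \<odot> \<langle>w\<rangle> \<in> (normal_span t :: ('i, 'k) nalg set)"
        using 1[OF vt]
      proof (rule span_linear_image[of _ _ "\<lambda>f. f \<odot> \<langle>w\<rangle>"])
        fix f :: "('i, 'k) nalg"
        assume "f \<in> mono_word ` {u. good u \<and> u \<le> v} \<union> S_words_in {..v}"
        then consider u where "good u" "u \<le> v" "f = \<langle>u\<rangle>" | "f \<in> S_words_in {..v}" by auto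
        then show "f \<odot> \<langle>w\<rangle> \<in> normal_span t"
        proof cases
          case 1
          \<comment> \<open>Being good, \<open>u\<close> differs from the bad \<open>v\<close>;
            strictness lets the induction hypothesis apply to the new product.\<close>
          with v have "u < v" by (metis le_less)
          then have "u \<diamondop> w < t"
            using word_less_lengthD[of u v] by (auto simp: t word_less_Node)
          then show ?thesis using IH by (simp add: 1 nmult_words)
        next
          case 2
          then show ?thesis
            by (intro S_span_normal_span S_span_right_le[of _ v]) (auto simp: t intro: nalg.span_base)
        qed
      qed (simp_all add: nmult_linear)
      then show ?thesis by (simp add: t nmult_words)
    next
      assume w: "\<not> good w"
      have "\<langle>v\<rangle> \<odot> \<langle>w\<rangle> \<in> (normal_span t :: ('i, 'k) nalg set)"
        using 1[OF wt]
      proof (rule span_linear_image[of _ _ "\<lambda>f. \<langle>v\<rangle> \<odot> f"])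
        fix f :: "('i, 'k) nalg"
        assume "f \<in> mono_word ` {u. good u \<and> u \<le> w} \<union> S_words_in {..w}"
        then consider u where "good u" "u \<le> w" "f = \<langle>u\<rangle>" | "f \<in> S_words_in {..w}" by auto
        then show "\<langle>v\<rangle> \<odot> f \<in> normal_span t"
        proof cases
          case 1
          with w have "u < w" by (metis le_less)
          then have "v \<diamondop> u < t"
            using word_less_lengthD[of u w] by (auto simp: t word_less_Node)
          then show ?thesis using IH by (simp add: 1 nmult_words)
        next
          case 2
          then show ?thesis
            by (intro S_span_normal_span S_span_left_le[of _ w]) (auto simp: t intro: nalg.span_base)
        qed
      qed (simp_all add: nmult_linear)
      then show ?thesis by (simp add: t nmult_words)
    next
      assume vw: "good v" "good w"
      with False obtain v1 v2 where v: "v = v1 \<diamondop> v2" "w < v2" unfolding t by (metis bad_NodeE)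
      \<comment> \<open>Solving \<open>rs\<close> for its leading word expresses \<open>t\<close> by
        these three smaller words.\<close>
      have less: "v1 \<diamondop> (v2 \<diamondop> w) < t" "v1 \<diamondop> w \<diamondop> v2 < t" "v1 \<diamondop> (w \<diamondop> v2) < t"
        using v assoc_less swap_less swap_assoc_less by (auto simp: t)
      have "\<langle>t\<rangle> = rs \<langle>v1\<rangle> \<langle>v2\<rangle> \<langle>w\<rangle> + \<langle>v1 \<diamondop> (v2 \<diamondop> w)\<rangle> + \<langle>v1 \<diamondop> w \<diamondop> v2\<rangle> - (\<langle>v1 \<diamondop> (w \<diamondop> v2)\<rangle> :: ('i, 'k) nalg)"
        by (simp add: rs_words t v)
      moreover have "(rs \<langle>v1\<rangle> \<langle>v2\<rangle> \<langle>w\<rangle> :: ('i, 'k) nalg) \<in> normal_span t"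
        using less vw v by (intro S_span_normal_span rs_good) (auto simp: t dest: good_NodeD)
      ultimately show ?thesis
        using less IH by (auto intro!: nalg.span_add nalg.span_diff)
    qed
  qed
qed

text \<open>Modulo bounded S-words, \<open>t\<close> is a combination of good words up to
  \<open>t\<close>, so a linear map may be tested on these and on the S-words.\<close>

lemma normal_span_linear_image:
  fixes \<phi> :: "('i::wellorder, 'k::field) nalg \<Rightarrow> ('i, 'k) nalg"
  assumes "\<And>f g. \<phi> (f + g) = \<phi> f + \<phi> g" "\<And>\<alpha> f. \<phi> (scale \<alpha> f) = scale \<alpha> (\<phi> f)" "\<phi> 0 = 0"
    and "\<And>u. good u \<Longrightarrow> u \<le> t \<Longrightarrow> \<phi> \<langle>u\<rangle> \<in> S_span A"
    and "\<And>f. f \<in> S_span {..t} \<Longrightarrow> \<phi> f \<in> S_span A"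
  shows "\<phi> \<langle>t\<rangle> \<in> S_span A"
  by (rule span_linear_image[OF word_in_normal_span]) (auto simp: assms(1-3) intro: assms(4,5) nalg.span_base)

text \<open>The arguments are reduced to good words one at a time, starting from
  \<open>rs_good\<close>: first the third, then the second, then the first. If an argument is a
  combination of bounded S-words, so is each of the four products in \<open>rs\<close>, by
  monotonicity.\<close>

lemma rs_in_S_span:
  fixes u v w :: "'i::wellorder word"
  assumes "u \<diamondop> v \<diamondop> w \<le> t" "u \<diamondop> w \<diamondop> v \<le> t"
  shows "(rs \<langle>u\<rangle> \<langle>v\<rangle> \<langle>w\<rangle> :: ('i, 'k::field) nalg) \<in> S_span {..t}"
proof -
  have le: "u' \<diamondop> (v' \<diamondop> w') \<le> t" if "u' \<diamondop> v' \<diamondop> w' \<le> t" for u' v' w'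
    using that assoc_less[of u' v' w'] by (rule order_trans[OF less_imp_le, rotated])
  have mono: "u' \<diamondop> v' \<diamondop> w' \<le> t \<and> u' \<diamondop> w' \<diamondop> v' \<le> t" if "u' \<le> u" "v' \<le> v" "w' \<le> w" for u' v' w'
    using that assms by (meson Node_le_mono order_trans)
  note intros = nalg.span_add nalg.span_diff S_span_left_le S_span_right_le order_refl le
  have 1: "rs \<langle>u'\<rangle> \<langle>v'\<rangle> \<langle>w\<rangle> \<in> (S_span {..t} :: ('i, 'k) nalg set)"
    if "good u'" "u' \<le> u" "good v'" "v' \<le> v" for u' v'
  proof (rule normal_span_linear_image)
    fix f :: "('i, 'k) nalg" assume "f \<in> S_span {..w}"
    then show "rs \<langle>u'\<rangle> \<langle>v'\<rangle> f \<in> S_span {..t}"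
      using mono[of u' v' w] that unfolding rs_def nmult_words by (auto intro!: intros)
  qed (use that mono in \<open>auto simp: rs_linear intro!: rs_good\<close>)
  have 2: "rs \<langle>u'\<rangle> \<langle>v\<rangle> \<langle>w\<rangle> \<in> (S_span {..t} :: ('i, 'k) nalg set)"
    if "good u'" "u' \<le> u" for u'
  proof (rule normal_span_linear_image[where \<phi> = "\<lambda>f. rs \<langle>u'\<rangle> f \<langle>w\<rangle>"])
    fix f :: "('i, 'k) nalg" assume "f \<in> S_span {..v}"
    then show "rs \<langle>u'\<rangle> f \<langle>w\<rangle> \<in> S_span {..t}"
      using mono[of u' v w] that unfolding rs_def nmult_words by (auto intro!: intros)
  qed (use that 1 in \<open>auto simp: rs_linear\<close>)
  show ?thesis
  proof (rule normal_span_linear_image[where \<phi> = "\<lambda>f. rs f \<langle>v\<rangle> \<langle>w\<rangle>"])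
    fix f :: "('i, 'k) nalg" assume "f \<in> S_span {..u}"
    then show "rs f \<langle>v\<rangle> \<langle>w\<rangle> \<in> S_span {..t}"
      using assms unfolding rs_def nmult_words by (auto intro!: intros)
  qed (use 2 in \<open>auto simp: rs_linear\<close>)
qed

section \<open>Compositions\<close>

text \<open>The larger of the two words is itself a weak bound, and it lies strictly below
  \<open>t\<close>.\<close>

lemma rs_in_S_span_less:
  fixes u v w :: "'i::wellorder word"
  assumes "u \<diamondop> v \<diamondop> w < t" "u \<diamondop> w \<diamondop> v < t"
  shows "(rs \<langle>u\<rangle> \<langle>v\<rangle> \<langle>w\<rangle> :: ('i, 'k::field) nalg) \<in> S_span {..<t}"
  using assms
  by (intro S_span_mono[OF rs_in_S_span[OF max.cobounded1 max.cobounded2]])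
    (auto simp: max_def split: if_splits)

text \<open>Both sides expand to the same words. Commutators are split into two \<open>rs\<close>
  terms on words, so that the bounds for words apply to each.\<close>

lemma hexagon:
  "rs (\<langle>a\<rangle> \<odot> \<langle>b\<rangle>) \<langle>c\<rangle> \<langle>d\<rangle> - rs \<langle>a\<rangle> \<langle>b\<rangle> \<langle>c\<rangle> \<odot> \<langle>d\<rangle> =
    rs \<langle>a \<diamondop> c\<rangle> \<langle>b\<rangle> \<langle>d\<rangle> - rs \<langle>a \<diamondop> d\<rangle> \<langle>b\<rangle> \<langle>c\<rangle> + rs \<langle>a\<rangle> \<langle>c\<rangle> \<langle>d\<rangle> \<odot> \<langle>b\<rangle> - rs \<langle>a\<rangle> \<langle>b\<rangle> \<langle>d\<rangle> \<odot> \<langle>c\<rangle>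
    - (rs \<langle>a\<rangle> \<langle>b\<rangle> \<langle>c \<diamondop> d\<rangle> - rs \<langle>a\<rangle> \<langle>b\<rangle> \<langle>d \<diamondop> c\<rangle>)
    + (rs \<langle>a\<rangle> \<langle>c\<rangle> \<langle>b \<diamondop> d\<rangle> - rs \<langle>a\<rangle> \<langle>c\<rangle> \<langle>d \<diamondop> b\<rangle>)
    - (rs \<langle>a\<rangle> \<langle>d\<rangle> \<langle>b \<diamondop> c\<rangle> - rs \<langle>a\<rangle> \<langle>d\<rangle> \<langle>c \<diamondop> b\<rangle>)
    + (\<langle>a\<rangle> \<odot> rs \<langle>b\<rangle> \<langle>c\<rangle> \<langle>d\<rangle> + \<langle>a\<rangle> \<odot> rs \<langle>c\<rangle> \<langle>d\<rangle> \<langle>b\<rangle> + \<langle>a\<rangle> \<odot> rs \<langle>d\<rangle> \<langle>b\<rangle> \<langle>c\<rangle>)"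
  by (simp add: rs_words nmult_words nmult_linear)

lemma composition_in_S_span:
  fixes a b c d :: "'i::wellorder word"
  assumes "c < b" "d < c"
  shows "(rs (\<langle>a\<rangle> \<odot> \<langle>b\<rangle>) \<langle>c\<rangle> \<langle>d\<rangle> - rs \<langle>a\<rangle> \<langle>b\<rangle> \<langle>c\<rangle> \<odot> \<langle>d\<rangle> :: ('i, 'k::field) nalg)
    \<in> S_span {..<a \<diamondop> b \<diamondop> c \<diamondop> d}"
proof -
  let ?t = "a \<diamondop> b \<diamondop> c \<diamondop> d"
  have lens: "word_length d \<le> word_length c" "word_length c \<le> word_length b"
    using assms by (auto dest: word_less_lengthD)
  note pos = word_length_pos[of a] word_length_pos[of b] word_length_pos[of c] word_length_pos[of d]
  have db: "d < b" using assms by (rule less_trans[rotated])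
  have shorter: "u \<diamondop> v < ?t"
    if "word_length u + word_length v = word_length ?t"
      "word_length u < word_length a + word_length b + word_length c" for u v
    using that word_less_lengthI[of u "a \<diamondop> b \<diamondop> c"] by (simp add: word_less_Node)
  have a_less: "a < a \<diamondop> b" using pos by (auto intro!: word_less_lengthI)
  have mult_right: "rs \<langle>a\<rangle> \<langle>u\<rangle> \<langle>v\<rangle> \<odot> \<langle>w\<rangle> \<in> (S_span {..<?t} :: ('i, 'k) nalg set)"
    if "v < u" "a \<diamondop> u \<diamondop> v \<diamondop> w < ?t" for u v w
    using that swap_less[OF that(1), of a]
    by (intro S_span_mono[OF S_span_right_le[OF rs_in_S_span[of _ _ _ "a \<diamondop> u \<diamondop> v"] order_refl]]) auto
  \<comment> \<open>No order of \<open>u\<close>, \<open>v\<close>, \<open>w\<close> is assumed,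
    since in the cyclic sum the term with \<open>c\<close>, \<open>d\<close>, \<open>b\<close> has
    its last two arguments increasing; the maximum covers both orders.\<close>
  have mult_left: "\<langle>a\<rangle> \<odot> rs \<langle>u\<rangle> \<langle>v\<rangle> \<langle>w\<rangle> \<in> (S_span {..<?t} :: ('i, 'k) nalg set)"
    if "word_length u + word_length v + word_length w = word_length b + word_length c + word_length d" for u v w
  proof -
    have "a \<diamondop> max (u \<diamondop> v \<diamondop> w) (u \<diamondop> w \<diamondop> v) < ?t"
      using that pos by (intro shorter) (auto simp: max_def)
    then show ?thesis
      by (intro S_span_mono[OF S_span_left_le[OF rs_in_S_span[OF max.cobounded1 max.cobounded2] order_refl]]) auto
  qed
  have bracket: "(rs \<langle>a\<rangle> \<langle>u\<rangle> \<langle>v \<diamondop> w\<rangle> :: ('i, 'k) nalg) \<in> S_span {..<?t}"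
    if "word_length u + word_length v + word_length w = word_length b + word_length c + word_length d"
      "word_length v + word_length w \<le> word_length b + word_length c"
      "word_length u < word_length b + word_length c" for u v w
  proof (rule rs_in_S_span_less)
    show "a \<diamondop> u \<diamondop> (v \<diamondop> w) < ?t"
      using that by (auto intro!: shorter)
    \<comment> \<open>If the left factors have equal length, as can happen for \<open>d\<close> with
      \<open>b\<close> and \<open>c\<close>, the comparison of \<open>a\<close> with
      \<open>a b\<close> decides.\<close>
    show "a \<diamondop> (v \<diamondop> w) \<diamondop> u < ?t"
      using that a_less by (auto simp: word_less_Node)
  qed
  \<comment> \<open>In the remaining words, unless a length decides earlier, the comparison comes
    down to \<open>a c\<close> or \<open>a d\<close> against \<open>a b\<close>, or to
    \<open>(a b) d\<close> against \<open>(a b) c\<close>.\<close>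
  show ?thesis
    unfolding hexagon
    by (intro nalg.span_add nalg.span_diff mult_left mult_right bracket rs_in_S_span_less)
      (use assms db lens pos in \<open>auto simp: word_less_Node\<close>)
qed

theorem theorem4p5:
  shows "groebner_shirshov_basis (S\<^sub>0 :: ('i::wellorder, 'k::field) nalg set)"
  unfolding groebner_shirshov_basis_def
proof (intro conjI ballI allI impI)
  \<comment> \<open>One letter suffices, because xx > x by length.\<close>
  let ?x = "Letter undefined :: 'i word"
  have "good ?x \<and> good (?x \<diamondop> ?x) \<and> good ?x \<and> ?x < ?x \<diamondop> ?x" by simp
  then show "(S\<^sub>0 :: ('i, 'k) nalg set) \<noteq> {}" unfolding S\<^sub>0_eq by blast
next
  fix f :: "('i, 'k) nalg"
  assume "f \<in> S\<^sub>0"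
  then show "monic f" by (auto simp: S\<^sub>0_eq lead_word_rs)
next
  fix f g h :: "('i, 'k) nalg" and C
  assume "f \<in> S\<^sub>0" "g \<in> S\<^sub>0" and comp: "composition C f g h"
  then obtain u v w u' v' w' where
    f: "f = rs \<langle>u\<rangle> \<langle>v\<rangle> \<langle>w\<rangle>" "good u" "good v" "good w" "w < v" and
    g: "g = rs \<langle>u'\<rangle> \<langle>v'\<rangle> \<langle>w'\<rangle>" "w' < v'"
    unfolding S\<^sub>0_eq by blast
  from comp f g have eq: "u \<diamondop> v \<diamondop> w = fill_word C (u' \<diamondop> v' \<diamondop> w')" and h: "h = f - fill_poly C g"
    by (simp_all add: composition_def lead_word_rs)
  have bad: "\<not> good (fill_word D (u' \<diamondop> v' \<diamondop> w'))" for D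
    using g by (auto dest!: good_fill_wordD)
  \<comment> \<open>The hole cannot lie within \<open>u\<close>, \<open>v\<close> or
    \<open>w\<close>, which are good; only the whole word and the factor \<open>u v\<close>
    remain.\<close>
  consider "C = Hole" | "C = CtxtL Hole w"
    using eq f bad
    by (cases C rule: ctxt.exhaust; simp) (metis ctxt.exhaust fill_word.simps word.inject(2))
  then have "h \<in> S_span {..<u \<diamondop> v \<diamondop> w}"
  proof cases
    \<comment> \<open>Equal leading words determine all three arguments, so f = g and the
      composition is zero.\<close>
    case 1
    with eq h f g show ?thesis by (simp add: nalg.span_zero)
  next
    case 2
    \<comment> \<open>This is the overview's situation with a = \<open>u'\<close>, b =
      \<open>v'\<close>, c = \<open>w'\<close> = \<open>v\<close> and d = \<open>w\<close>;
      membership of both elements in \<open>S\<^sub>0\<close> gives b > c > d.\<close>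
    with eq have "u = u' \<diamondop> v'" "v = w'" by auto
    with 2 h f g show ?thesis
      using composition_in_S_span[of w' v' w u'] by (simp add: nmult_words)
  qed
  then show "trivial_mod S\<^sub>0 (lead_word f) h"
    using f by (simp add: lead_word_rs trivial_mod_S_span)
qed

end
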